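(* Let $0<r<1$ and $R(r,1)=\{z\in\mathbb{C} : r<|z|<1\}$. For all $x,y\in R(r,1)$, $$\frac{1}{2}s_{R(r,1)}(x,y)\leq j^*_{R(r,1)}(x,y)\leq \tanh\frac{\delta_{R(r,1)}(x,y)}{2}\leq 2j^*_{R(r,1)}(x,y)\leq 2s_{R(r,1)}(x,y).$$ Moreover, the constants $1/2$ and $1$ in the lower bounds for $\tanh(\delta_{R(r,1)}/2)$ are sharp when $r\to0^+$, i.e. $$\lim_{r\to0^+}\ \inf_{x\neq y\in R(r,1)}\frac{\tanh(\delta_{R(r,1)}(x,y)/2)}{s_{R(r,1)}(x,y)}=\frac12,\qquad \lim_{r\to0^+}\ \inf_{x\neq y\in R(r,1)}\frac{\tanh(\delta_{R(r,1)}(x,y)/2)}{j^*_{R(r,1)}(x,y)}=1,$$ and the constants $2$ in the upper bounds for $\tanh(\delta_{R(r,1)}/2)$ are sharp for every $r\in(0,1)$, i.e. $$\sup_{x\neq y\in R(r,1)}\frac{\tanh(\delta_{R(r,1)}(x,y)/2)}{j^*_{R(r,1)}(x,y)}=\sup_{x\neq y\in R(r,1)}\frac{\tanh(\delta_{R(r,1)}(x,y)/2)}{s_{R(r,1)}(x,y)}=2.$$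
   Context: For a domain $G\subsetneq\mathbb{R}^n$ and $x\in G$, $d_G(x)=\inf\{|x-z| : z\in\partial G\}$. Triangular ratio metric: $s_G(x,y)=\dfrac{|x-y|}{\inf_{z\in\partial G}(|x-z|+|z-y|)}$. $j^*$-metric: $j^*_G(x,y)=\dfrac{|x-y|}{|x-y|+2\min\{d_G(x),d_G(y)\}}$. Möbius metric: for a domain $G\subset\overline{\mathbb{R}}^n=\mathbb{R}^n\cup\{\infty\}$ whose complement in $\overline{\mathbb{R}}^n$ has at least two points, $\delta_G(x,y)=\sup_{a,b\in\partial G}\log(1+|a,x,b,y|)$, where $|a,b,c,d|=\dfrac{|a-c||b-d|}{|a-b||c-d|}$ for points of $\mathbb{R}^n$ (value $0$ when $a=c$ or $b=d$). *)

theory Defs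
  imports "HOL-Analysis.Analysis"
begin

definition triangular_ratio_metric :: "'a::euclidean_space set \<Rightarrow> 'a \<Rightarrow> 'a \<Rightarrow> real"
  where "triangular_ratio_metric G x y =
    norm (x - y) / (INF z\<in>frontier G. norm (x - z) + norm (z - y))"

(* infdist x (frontier G) is the boundary distance d_G(x); the library's default value 0
   for an empty boundary is irrelevant for proper subdomains of the whole space. *)
definition j_star_metric :: "'a::euclidean_space set \<Rightarrow> 'a \<Rightarrow> 'a \<Rightarrow> real"
  where "j_star_metric G x y =
    norm (x - y) / (norm (x - y) + 2 * min (infdist x (frontier G)) (infdist y (frontier G)))"

definition cross_ratio :: "'a::euclidean_space \<Rightarrow> 'a \<Rightarrow> 'a \<Rightarrow> 'a \<Rightarrow> real"
  where "cross_ratio a b c d = (norm (a - c) * norm (b - d)) / (norm (a - b) * norm (c - d))"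

(* Moebius metric of a bounded domain G. In general the boundary is taken in the one-point
   compactification; for bounded G, infinity is not a boundary point and the boundary is
   frontier G. For unbounded G this definition omits the pairs involving infinity. *)
definition moebius_metric :: "'a::euclidean_space set \<Rightarrow> 'a \<Rightarrow> 'a \<Rightarrow> real"
  where "moebius_metric G x y =
    (SUP (a, b)\<in>frontier G \<times> frontier G. ln (1 + cross_ratio a x b y))"

definition annulus :: "real \<Rightarrow> real \<Rightarrow> complex set"
  where "annulus r R = {z. r < norm z \<and> norm z < R}"

definition distinct_pairs :: "'a set \<Rightarrow> ('a \<times> 'a) set"
  where "distinct_pairs G = {(x, y). x \<in> G \<and> y \<in> G \<and> x \<noteq> y}"

end

theory Submission
  imports Defs
begin

text \<open>
  With \<open>t = |x - y|\<close>, \<open>d = min (d\<^sub>G x) (d\<^sub>G y)\<close> and \<open>M = sup |a,x,b,y|\<close> one has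
  \<open>tanh (\<delta>/2) = M / (M + 2)\<close> and \<open>j* = (t/d) / (t/d + 2)\<close>, so the inequalities compare \<open>M\<close> with
  \<open>t/d\<close>; they hold in every bounded open set. If \<open>a\<close> is the boundary point nearest to \<open>x\<close> and \<open>b\<close> is
  where the ray from \<open>a\<close> through \<open>y\<close> leaves \<open>G\<close> after \<open>y\<close>, then \<open>|a - b| \<ge> |b - y|\<close> and
  \<open>M \<ge> t/d\<close>. Conversely \<open>|a - b| \<le> |a - x| + t + |b - y|\<close> gives \<open>1 + M \<le> (1 + t/d)\<^sup>2\<close>.
  The lower constants are approached along \<open>x = \<surd>r\<close>, \<open>y = -\<surd>r\<close>: the segment crosses the
  boundary, so \<open>s \<ge> 1\<close>, while \<open>M\<close> is close to \<open>2\<close>. The upper ones are approached for \<open>x\<close> midway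
  between the two circles and \<open>y\<close> tending to \<open>x\<close> radially, with \<open>a, b\<close> radially opposite.
\<close>

section \<open>Cross ratios and their image under \<open>tanh (ln (1 + K) / 2)\<close>\<close>

text \<open>Writing the argument as \<open>ln s\<close> with \<open>s = sqrt (1 + K)\<close>, this
  is \<open>tanh (ln s) = (s^2 - 1) / (s^2 + 1)\<close>. It turns the logarithmic metric into a
  rational function of the cross ratio.\<close>

lemma tanh_half_ln:
  fixes K :: real
  assumes "0 \<le> K"
  shows "tanh (ln (1 + K) / 2) = K / (K + 2)"
proof -
  have "ln (1 + K) / 2 = ln (sqrt (1 + K))"
    using assms by (simp add: ln_sqrt)
  then show ?thesis
    using assms by (simp add: tanh_ln_real add.commute)
qed

text \<open>This symmetry allows the roles of \<open>x\<close> and \<open>y\<close> to be exchanged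
  when \<open>y\<close> is the point nearer to the boundary.\<close>

lemma cross_ratio_commute: "cross_ratio b y a x = cross_ratio a x b y"
  by (simp add: cross_ratio_def norm_minus_commute mult.commute)

lemma cross_ratio_nonneg: "0 \<le> cross_ratio a b c d"
  by (simp add: cross_ratio_def)

lemma frontier_nonempty_bounded:
  fixes G :: "'a::euclidean_space set"
  assumes "bounded G" "x \<in> G"
  shows "frontier G \<noteq> {}"
  using assms frontier_not_empty not_bounded_UNIV by blast

lemma infdist_frontier_pos:
  fixes G :: "'a::euclidean_space set"
  assumes "open G" "bounded G" "x \<in> G"
  shows "0 < infdist x (frontier G)"
  using assms frontier_nonempty_bounded[of G x]
  by (intro infdist_pos_not_in_closed) (auto simp: frontier_def interior_open)

lemma cross_ratio_le:
  fixes a b x y :: "'a::euclidean_space"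
  assumes "0 < d" "d \<le> norm (a - x)" "d \<le> norm (b - y)"
  shows "cross_ratio a x b y \<le> (1 + norm (x - y) / d)\<^sup>2 - 1"
proof -
  define p q t where "p = norm (a - x)" and "q = norm (b - y)" and "t = norm (x - y)"
  have pq: "d \<le> p" "d \<le> q" "0 \<le> t" "0 < p" "0 < q"
    using assms by (auto simp: p_def q_def t_def)
  have "norm (a - b) = norm ((a - x) + (x - y) + (y - b))" by simp
  also have "\<dots> \<le> p + t + q"
    unfolding p_def q_def t_def
    by (metis norm_triangle_le norm_triangle_ineq add_right_mono norm_minus_commute)
  finally have ab: "norm (a - b) \<le> p + t + q" .
  have "cross_ratio a x b y = norm (a - b) * t / (p * q)"
    by (simp add: cross_ratio_def p_def q_def t_def norm_minus_commute)
  also have "\<dots> \<le> (p + t + q) * t / (p * q)"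
    using ab pq by (intro divide_right_mono mult_right_mono) auto
  \<comment> \<open>The bound factors because
    \<open>(p + t + q) * t + p * q = (p + t) * (q + t)\<close>.\<close>
  also have "\<dots> = (1 + t / p) * (1 + t / q) - 1"
    using pq by (simp add: field_simps)
  also have "\<dots> \<le> (1 + t / d) * (1 + t / d) - 1"
    using pq assms(1) by (intro diff_right_mono mult_mono add_left_mono divide_left_mono) auto
  finally show ?thesis by (simp add: t_def power2_eq_square)
qed

lemma cross_ratio_frontier_le:
  fixes G :: "'a::euclidean_space set"
  assumes "open G" "bounded G" "x \<in> G" "y \<in> G" "a \<in> frontier G" "b \<in> frontier G"
  shows "cross_ratio a x b y \<le>
    (1 + norm (x - y) / min (infdist x (frontier G)) (infdist y (frontier G)))\<^sup>2 - 1"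
proof (rule cross_ratio_le)
  show "0 < min (infdist x (frontier G)) (infdist y (frontier G))"
    using assms infdist_frontier_pos by auto
  show "min (infdist x (frontier G)) (infdist y (frontier G)) \<le> norm (a - x)"
    using infdist_le[OF assms(5), of x] by (simp add: dist_norm norm_minus_commute)
  show "min (infdist x (frontier G)) (infdist y (frontier G)) \<le> norm (b - y)"
    using infdist_le[OF assms(6), of y] by (simp add: dist_norm norm_minus_commute)
qed

section \<open>The Moebius metric as a supremum over pairs of boundary points\<close>

lemma moebius_metric_le:
  fixes G :: "'a::euclidean_space set"
  assumes "bounded G" "x \<in> G"
    and le: "\<And>a b. a \<in> frontier G \<Longrightarrow> b \<in> frontier G \<Longrightarrow> cross_ratio a x b y \<le> K"
  shows "moebius_metric G x y \<le> ln (1 + K)"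
  unfolding moebius_metric_def
proof (rule cSUP_least, goal_cases)
  case 1
  then show ?case using frontier_nonempty_bounded[OF assms(1,2)] by auto
next
  case (2 p)
  then obtain a b where "p = (a, b)" "a \<in> frontier G" "b \<in> frontier G" by auto
  with le[of a b] cross_ratio_nonneg[of a x b y] show ?case by auto
qed

lemma moebius_metric_ge:
  fixes G :: "'a::euclidean_space set"
  assumes "open G" "bounded G" "x \<in> G" "y \<in> G" "a \<in> frontier G" "b \<in> frontier G"
  shows "ln (1 + cross_ratio a x b y) \<le> moebius_metric G x y"
proof -
  define C where "C = (1 + norm (x - y) / min (infdist x (frontier G)) (infdist y (frontier G)))\<^sup>2 - 1"
  \<comment> \<open>A real \<open>SUP\<close> is known to dominate its members only if they are
    bounded above; positive distance of \<open>x\<close> and \<open>y\<close> from the boundary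
    provides the bound.\<close>
  have "bdd_above ((\<lambda>(a, b). ln (1 + cross_ratio a x b y)) ` (frontier G \<times> frontier G))"
  proof (rule bdd_aboveI2)
    fix p assume "p \<in> frontier G \<times> frontier G"
    then obtain a b where p: "p = (a, b)" "a \<in> frontier G" "b \<in> frontier G" by auto
    then have "cross_ratio a x b y \<le> C"
      unfolding C_def using cross_ratio_frontier_le assms by blast
    then show "(case p of (a, b) \<Rightarrow> ln (1 + cross_ratio a x b y)) \<le> ln (1 + C)"
      using p cross_ratio_nonneg[of a x b y] by auto
  qed
  from cSUP_upper[OF _ this, of "(a, b)"] assms(5,6) show ?thesis
    by (simp add: moebius_metric_def)
qed

lemma tanh_half_moebius_le:
  fixes G :: "'a::euclidean_space set"
  assumes "bounded G" "x \<in> G"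
    and le: "\<And>a b. a \<in> frontier G \<Longrightarrow> b \<in> frontier G \<Longrightarrow> cross_ratio a x b y \<le> K"
  shows "tanh (moebius_metric G x y / 2) \<le> K / (K + 2)"
proof -
  obtain a where "a \<in> frontier G" using frontier_nonempty_bounded[OF assms(1,2)] by auto
  \<comment> \<open>The hypothesis at any single pair, here \<open>(a, a)\<close>, already forces
    \<open>K\<close> to be nonnegative.\<close>
  then have "0 \<le> K" using le[of a a] cross_ratio_nonneg[of a x a y] by linarith
  moreover have "tanh (moebius_metric G x y / 2) \<le> tanh (ln (1 + K) / 2)"
    using moebius_metric_le[OF assms] by simp
  ultimately show ?thesis by (simp add: tanh_half_ln)
qed

lemma tanh_half_moebius_ge:
  fixes G :: "'a::euclidean_space set"
  assumes "open G" "bounded G" "x \<in> G" "y \<in> G" "a \<in> frontier G" "b \<in> frontier G"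
    and "0 \<le> K" "K \<le> cross_ratio a x b y"
  shows "K / (K + 2) \<le> tanh (moebius_metric G x y / 2)"
proof -
  have "ln (1 + K) \<le> moebius_metric G x y"
    using moebius_metric_ge[OF assms(1-6)] assms(7,8) by (smt (verit) ln_le_cancel_iff)
  then have "tanh (ln (1 + K) / 2) \<le> tanh (moebius_metric G x y / 2)" by simp
  then show ?thesis using assms(7) by (simp add: tanh_half_ln)
qed

section \<open>Comparison of the Moebius metric with \<open>j_star_metric\<close>\<close>

text \<open>With \<open>a\<close> nearest to \<open>x\<close>, the cross ratio is the left side
  times \<open>norm (a - b) / norm (b - y)\<close>. This factor is at least 1 once \<open>y\<close>
  lies between \<open>a\<close> and \<open>b\<close>, and such a \<open>b\<close> exists because the
  ray from \<open>a\<close> through \<open>y\<close> must leave the bounded set.\<close>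

lemma exists_cross_ratio_ge:
  fixes G :: "'a::euclidean_space set"
  assumes "open G" "bounded G" "x \<in> G" "y \<in> G"
  obtains a b where "a \<in> frontier G" "b \<in> frontier G"
    "norm (x - y) / infdist x (frontier G) \<le> cross_ratio a x b y"
proof -
  obtain a where a: "a \<in> frontier G" "infdist x (frontier G) = dist x a"
    using infdist_attains_inf[OF frontier_closed frontier_nonempty_bounded] assms by metis
  have "y \<noteq> a"
    using a assms by (auto simp: frontier_def interior_open)
  then obtain c where c: "0 < c" "y + c *\<^sub>R (y - a) \<in> frontier G"
    using ray_to_frontier[of G y "y - a"] assms by (auto simp: interior_open)
  define b where "b = y + c *\<^sub>R (y - a)"
  \<comment> \<open>Collinearity makes both distances explicit: they are \<open>1 + c\<close> and
    \<open>c\<close> times \<open>norm (y - a)\<close>.\<close>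
  have "a - b = - (1 + c) *\<^sub>R (y - a)"
    by (simp add: b_def algebra_simps)
  then have "norm (a - b) = (1 + c) * norm (y - a)" using c
    by simp
  moreover have "norm (b - y) = c * norm (y - a)" using c by (simp add: b_def)
  ultimately have nb: "norm (b - y) \<le> norm (a - b)" "0 < norm (b - y)"
    using c \<open>y \<noteq> a\<close> by (auto simp: algebra_simps)
  have "norm (x - y) / infdist x (frontier G) \<le>
      norm (x - y) / infdist x (frontier G) * (norm (a - b) / norm (b - y))"
    using nb infdist_nonneg[of x "frontier G"] by (intro mult_le_cancel_left1[THEN iffD2]) (auto simp: not_less divide_less_0_iff)
  also have "\<dots> = cross_ratio a x b y"
    using a(2) by (simp add: cross_ratio_def dist_norm norm_minus_commute)
  finally show ?thesis using that a(1) c(2) b_def by blast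
qed

lemma j_star_le_tanh_half_moebius:
  fixes G :: "'a::euclidean_space set"
  assumes "open G" "bounded G" "x \<in> G" "y \<in> G"
  shows "j_star_metric G x y \<le> tanh (moebius_metric G x y / 2)"
proof -
  define d t where "d = min (infdist x (frontier G)) (infdist y (frontier G))" and "t = norm (x - y)"
  have dt: "0 < d" "0 \<le> t"
    using assms infdist_frontier_pos by (auto simp: d_def t_def)
  obtain a b where ab: "a \<in> frontier G" "b \<in> frontier G" "t / d \<le> cross_ratio a x b y"
  \<comment> \<open>The previous lemma is applied at whichever point realizes the minimum
    \<open>d\<close>.\<close>
  proof (cases "infdist x (frontier G) \<le> infdist y (frontier G)")
    case True
    then show ?thesis
      using exists_cross_ratio_ge[OF assms] that by (auto simp: d_def t_def)
  next
    case False
    then show ?thesis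
      using exists_cross_ratio_ge[OF assms(1,2,4,3)] that
      by (metis cross_ratio_commute d_def t_def min_def norm_minus_commute)
  qed
  have "j_star_metric G x y = (t / d) / (t / d + 2)"
    using dt unfolding j_star_metric_def d_def[symmetric] t_def[symmetric]
    by (simp add: field_simps)
  also have "\<dots> \<le> tanh (moebius_metric G x y / 2)"
    using dt ab by (intro tanh_half_moebius_ge[OF assms]) auto
  finally show ?thesis .
qed

lemma tanh_half_moebius_le_j_star:
  fixes G :: "'a::euclidean_space set"
  assumes "open G" "bounded G" "x \<in> G" "y \<in> G"
  shows "tanh (moebius_metric G x y / 2) \<le> 2 * j_star_metric G x y"
proof -
  define d t where "d = min (infdist x (frontier G)) (infdist y (frontier G))" and "t = norm (x - y)"
  have dt: "0 < d" "0 \<le> t"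
    using assms infdist_frontier_pos by (auto simp: d_def t_def)
  define u where "u = t / d"
  have u: "0 \<le> u" using dt by (simp add: u_def)
  have "tanh (moebius_metric G x y / 2) \<le> ((1 + u)\<^sup>2 - 1) / (((1 + u)\<^sup>2 - 1) + 2)"
    unfolding u_def d_def t_def
    by (rule tanh_half_moebius_le) (use assms cross_ratio_frontier_le in blast)+
  also have "\<dots> \<le> 2 * (u / (u + 2))"
  proof -
    have "(u * (u + 2)) * (u + 2) \<le> (2 * u) * (u\<^sup>2 + 2 * u + 2)"
    proof -
      \<comment> \<open>After clearing denominators the two sides differ by exactly
        \<open>u ^ 3\<close>. Both sides are \<open>4 * u\<close> to first order, so nothing is lost
        in the limit of small \<open>u\<close>, where the constant 2 is approached.\<close>
      have "(2 * u) * (u\<^sup>2 + 2 * u + 2) - (u * (u + 2)) * (u + 2) = u ^ 3"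
        by (simp add: algebra_simps power2_eq_square power3_eq_cube)
      with u show ?thesis by (smt (verit) zero_le_power)
    qed
    then have "(u * (u + 2)) / (u\<^sup>2 + 2 * u + 2) \<le> (2 * u) / (u + 2)"
      using u by (subst frac_le_eq) (auto simp: add_nonneg_eq_0_iff divide_le_0_iff algebra_simps)
    moreover have "(1 + u)\<^sup>2 - 1 = u * (u + 2)" "(1 + u)\<^sup>2 - 1 + 2 = u\<^sup>2 + 2 * u + 2"
      by (simp_all add: power2_eq_square algebra_simps)
    ultimately show ?thesis by simp
  qed
  also have "u / (u + 2) = j_star_metric G x y"
    using dt unfolding j_star_metric_def d_def[symmetric] t_def[symmetric] u_def
    by (simp add: field_simps)
  finally show ?thesis .
qed

section \<open>Comparison of the triangular ratio metric with \<open>j_star_metric\<close>\<close>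

lemma bdd_below_norm_sum: "bdd_below ((\<lambda>z. norm (x - z) + norm (z - y)) ` S)"
  by (rule bdd_belowI2[of _ 0]) simp

text \<open>Only the denominators differ. A detour through the boundary point nearest to
  \<open>x\<close> or to \<open>y\<close> gives \<open>I \<le> t + 2 * d\<close>; adding
  \<open>t \<le> I\<close> and \<open>2 * d \<le> I\<close> gives
  \<open>t + 2 * d \<le> 2 * I\<close>.\<close>

lemma j_star_le_triangular_ratio:
  fixes G :: "'a::euclidean_space set"
  assumes "open G" "bounded G" "x \<in> G" "y \<in> G"
  shows "j_star_metric G x y \<le> triangular_ratio_metric G x y"
    and "triangular_ratio_metric G x y \<le> 2 * j_star_metric G x y"
proof -
  define d t I where "d = min (infdist x (frontier G)) (infdist y (frontier G))"
    and "t = norm (x - y)" and "I = (INF z\<in>frontier G. norm (x - z) + norm (z - y))"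
  have dt: "0 < d" "0 \<le> t"
    using assms infdist_frontier_pos by (auto simp: d_def t_def)
  have ne: "frontier G \<noteq> {}" using frontier_nonempty_bounded assms by blast
  have bound: "t \<le> norm (x - z) + norm (z - y)" for z
    unfolding t_def using norm_triangle_ineq[of "x - z" "z - y"] by simp
  have "I \<le> t + 2 * infdist x (frontier G)"
  proof -
    obtain a where a: "a \<in> frontier G" "infdist x (frontier G) = dist x a"
      using infdist_attains_inf[OF frontier_closed ne] by metis
    have "I \<le> norm (x - a) + norm (a - y)"
      unfolding I_def by (rule cINF_lower[OF bdd_below_norm_sum a(1)])
    also have "norm (a - y) \<le> norm (x - a) + t"
      unfolding t_def using norm_triangle_ineq[of "a - x" "x - y"] by (simp add: norm_minus_commute)
    finally show ?thesis using a(2) by (simp add: dist_norm)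
  qed
  moreover have "I \<le> t + 2 * infdist y (frontier G)"
  proof -
    obtain a where a: "a \<in> frontier G" "infdist y (frontier G) = dist y a"
      using infdist_attains_inf[OF frontier_closed ne] by metis
    have "I \<le> norm (x - a) + norm (a - y)"
      unfolding I_def by (rule cINF_lower[OF bdd_below_norm_sum a(1)])
    also have "norm (x - a) \<le> t + norm (a - y)"
      unfolding t_def using norm_triangle_ineq[of "x - y" "y - a"] by (simp add: norm_minus_commute)
    finally show ?thesis using a(2) by (simp add: dist_norm norm_minus_commute)
  qed
  ultimately have upper: "I \<le> t + 2 * d" unfolding d_def by linarith
  have "2 * d \<le> norm (x - z) + norm (z - y)" if "z \<in> frontier G" for z
    using infdist_le[OF that, of x] infdist_le[OF that, of y]
    unfolding d_def dist_norm by (simp add: norm_minus_commute)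
  then have "2 * d \<le> I" unfolding I_def by (intro cINF_greatest ne)
  moreover have "t \<le> I" unfolding I_def using bound by (intro cINF_greatest ne)
  ultimately have "0 < I" "t + 2 * d \<le> 2 * I" using dt by auto
  have "t / (t + 2 * d) \<le> t / I"
    using dt upper \<open>0 < I\<close> by (intro divide_left_mono) auto
  moreover have "t / I \<le> 2 * (t / (t + 2 * d))"
  proof -
    have "2 * t / (2 * I) \<le> 2 * t / (t + 2 * d)"
      using dt \<open>t + 2 * d \<le> 2 * I\<close> by (intro divide_left_mono) auto
    then show ?thesis by simp
  qed
  ultimately show "j_star_metric G x y \<le> triangular_ratio_metric G x y"
    and "triangular_ratio_metric G x y \<le> 2 * j_star_metric G x y"
    unfolding j_star_metric_def triangular_ratio_metric_def
      d_def[symmetric] t_def[symmetric] I_def[symmetric] by auto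
qed

lemma j_star_pos:
  fixes G :: "'a::euclidean_space set"
  assumes "open G" "bounded G" "x \<in> G" "y \<in> G" "x \<noteq> y"
  shows "0 < j_star_metric G x y"
  using infdist_frontier_pos[OF assms(1,2,3)] infdist_frontier_pos[OF assms(1,2,4)] assms(5)
  unfolding j_star_metric_def by (intro divide_pos_pos add_pos_pos) auto

text \<open>On the segment the triangle inequality is an equality, so the infimum in the denominator
  is at most \<open>norm (x - y)\<close>.\<close>

lemma triangular_ratio_ge_1:
  fixes G :: "'a::euclidean_space set"
  assumes G: "open G" "bounded G" and xy: "x \<in> G" "y \<in> G"
    and z: "z \<in> frontier G" "z \<in> closed_segment x y"
  shows "1 \<le> triangular_ratio_metric G x y"
proof -
  define I where "I = (INF z\<in>frontier G. norm (x - z) + norm (z - y))"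
  have "x \<noteq> y" using z G(1) xy by (auto simp: frontier_def interior_open)
  \<comment> \<open>Positivity of \<open>I\<close> is read off from that of the whole quotient,
    which dominates the positive \<open>j_star_metric\<close>.\<close>
  then have "0 < norm (x - y) / I"
    using j_star_pos[OF G xy] j_star_le_triangular_ratio(1)[OF G xy]
    by (simp add: triangular_ratio_metric_def I_def)
  then have "0 < I" using \<open>x \<noteq> y\<close> by (simp add: zero_less_divide_iff)
  have "I \<le> norm (x - z) + norm (z - y)"
    unfolding I_def by (rule cINF_lower[OF bdd_below_norm_sum z(1)])
  also have "\<dots> = norm (x - y)"
    using z(2) by (simp add: between_mem_segment[symmetric] between dist_norm)
  finally show ?thesis
    using \<open>0 < I\<close> by (simp add: triangular_ratio_metric_def I_def)
qed

section \<open>The boundary of an annulus\<close>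

lemma open_annulus: "open (annulus r R)"
  unfolding annulus_def by (intro open_Collect_conj open_Collect_less continuous_intros)

lemma bounded_annulus: "bounded (annulus r R)"
  by (rule bounded_subset[of "ball 0 R"]) (auto simp: annulus_def)

lemma norm_frontier_annulus:
  assumes "z \<in> frontier (annulus r R)"
  shows "norm z = r \<or> norm z = R"
proof -
  have "closed {z::complex. r \<le> norm z \<and> norm z \<le> R}"
    by (intro closed_Collect_conj closed_Collect_le continuous_intros)
  then have "closure (annulus r R) \<subseteq> {z. r \<le> norm z \<and> norm z \<le> R}"
    by (intro closure_minimal) (auto simp: annulus_def)
  moreover have "z \<in> closure (annulus r R)" "z \<notin> annulus r R"
    using assms by (auto simp: frontier_def interior_open[OF open_annulus])
  ultimately have "r \<le> norm z" "norm z \<le> R" "\<not> (r < norm z \<and> norm z < R)"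
    by (auto simp only: annulus_def mem_Collect_eq)
  then show ?thesis by linarith
qed

lemma of_real_frontier_annulus:
  assumes "0 < r" "r < R"
  shows "of_real r \<in> frontier (annulus r R)" "of_real R \<in> frontier (annulus r R)"
proof -
  \<comment> \<open>Continuity of the embedding carries the closure \<open>{r..R}\<close> of the
    open interval into the closure of its image.\<close>
  have "of_real ` {r..R} \<subseteq> closure (of_real ` {r<..<R} :: complex set)"
    using image_closure_subset[of "{r<..<R}" of_real "closure (complex_of_real ` {r<..<R})"]
      closure_subset[of "of_real ` {r<..<R} :: complex set"] assms
    by (simp add: continuous_on_of_real_id)
  also have "\<dots> \<subseteq> closure (annulus r R)"
    using assms by (intro closure_mono) (auto simp: annulus_def)
  finally have "of_real r \<in> closure (annulus r R)" "of_real R \<in> closure (annulus r R)"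
    using assms by auto
  moreover have "of_real r \<notin> annulus r R" "of_real R \<notin> annulus r R"
    using assms by (auto simp: annulus_def)
  ultimately show "of_real r \<in> frontier (annulus r R)" "of_real R \<in> frontier (annulus r R)"
    by (auto simp: frontier_def interior_open[OF open_annulus])
qed

section \<open>Extremal pairs of points in an annulus\<close>

text \<open>The radius \<open>k\<close> is the geometric mean of the two boundary radii, so
  inversion in the circle of radius \<open>k\<close> swaps the boundary circles and fixes both
  points. The estimate uses only the norms of \<open>a\<close> and \<open>b\<close>, and the bound
  tends to 2 as \<open>k\<close> tends to 0.\<close>

lemma cross_ratio_opposite_le:
  fixes a b :: complex and k :: real
  assumes k: "0 < k" "k < 1"
    and a: "norm a = k\<^sup>2 \<or> norm a = 1" and b: "norm b = k\<^sup>2 \<or> norm b = 1"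
  shows "cross_ratio a (of_real k) b (- of_real k) \<le> 2 * (1 + k\<^sup>2) / (1 - k)\<^sup>2"
proof -
  have ab: "norm (a - b) \<le> norm a + norm b" by (rule norm_triangle_ineq4)
  have pos: "0 < norm c * \<bar>norm c - k\<bar>" if "norm c = k\<^sup>2 \<or> norm c = 1" for c :: complex
    using that k by (auto simp: power2_eq_square)
  have ax: "\<bar>norm a - k\<bar> \<le> norm (a - of_real k)"
    using norm_triangle_ineq3[of a "of_real k"] k by simp
  have bx: "\<bar>norm b - k\<bar> \<le> norm (b + of_real k)"
    using norm_triangle_ineq3[of b "- of_real k"] k by simp
  have two_k: "norm (of_real k + of_real k :: complex) = 2 * k"
    using k by (simp flip: of_real_add)
  have "cross_ratio a (of_real k) b (- of_real k) =
      norm (a - b) * (2 * k) / (norm (a - of_real k) * norm (b + of_real k))"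
    using k two_k by (simp add: cross_ratio_def norm_minus_commute add.commute)
  also have "\<dots> \<le> (norm a + norm b) * (2 * k) / (\<bar>norm a - k\<bar> * \<bar>norm b - k\<bar>)"
    using pos[OF a] pos[OF b] ab ax bx k
    by (intro frac_le mult_right_mono mult_mono mult_pos_pos mult_nonneg_nonneg)
      (auto simp: zero_less_mult_iff)
  also have "\<dots> \<le> 2 * (1 + k\<^sup>2) / (1 - k)\<^sup>2"
  proof -
    \<comment> \<open>For \<open>a\<close> and \<open>b\<close> on different circles the left side
      equals the bound. On a common circle it is \<open>4 * k / (1 - k)\<^sup>2\<close>, where this
      inequality is what remains.\<close>
    have "2 * k \<le> 1 + k\<^sup>2" using sum_squares_bound[of 1 k] by simp
    moreover have 1: "\<bar>k\<^sup>2 - k\<bar> = k * (1 - k)" using k by (simp add: power2_eq_square algebra_simps)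
    moreover have "\<bar>1 - k\<bar> = 1 - k" using k by simp
    ultimately show ?thesis
      using a b k by (elim disjE) (auto simp: power2_eq_square divide_simps mult_le_cancel_right)
  qed
  finally show ?thesis .
qed

text \<open>The last bound tends to \<open>1 / 2\<close> as \<open>k\<close> tends to 0, so these
  pairs approach both lower constants.\<close>

lemma exists_small_moebius_annulus:
  assumes k: "0 < k" "k < 1"
  obtains x y where "(x, y) \<in> distinct_pairs (annulus (k\<^sup>2) 1)"
    "1 \<le> triangular_ratio_metric (annulus (k\<^sup>2) 1) x y"
    "tanh (moebius_metric (annulus (k\<^sup>2) 1) x y / 2) \<le> (1 + k\<^sup>2) / ((1 + k\<^sup>2) + (1 - k)\<^sup>2)"
proof -
  define G where "G = annulus (k\<^sup>2) 1"
  define x y :: complex where "x = of_real k" and "y = - of_real k"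
  have G: "open G" "bounded G" by (auto simp: G_def open_annulus bounded_annulus)
  have xy: "x \<in> G" "y \<in> G"
    using k by (auto simp: x_def y_def G_def annulus_def power2_eq_square)
  \<comment> \<open>The midpoint is 0, in the hole of the annulus; connectedness then puts a
    boundary point on the segment.\<close>
  have "midpoint x y \<notin> G"
    using k by (simp add: x_def y_def G_def annulus_def midpoint_def)
  then have "midpoint x y \<in> closed_segment x y - G" by simp
  moreover have "x \<in> closed_segment x y \<inter> G" using xy by simp
  ultimately have "closed_segment x y \<inter> frontier G \<noteq> {}"
    by (intro connected_Int_frontier connected_segment) blast+
  then obtain z where "z \<in> frontier G" "z \<in> closed_segment x y" by auto
  then have s: "1 \<le> triangular_ratio_metric G x y"
    using triangular_ratio_ge_1 G xy by blast
  have "tanh (moebius_metric G x y / 2) \<le>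
      (2 * (1 + k\<^sup>2) / (1 - k)\<^sup>2) / (2 * (1 + k\<^sup>2) / (1 - k)\<^sup>2 + 2)"
    using G xy cross_ratio_opposite_le[OF k] norm_frontier_annulus
    unfolding G_def x_def y_def by (intro tanh_half_moebius_le) blast+
  also have "\<dots> = (1 + k\<^sup>2) / ((1 + k\<^sup>2) + (1 - k)\<^sup>2)"
  proof -
    have "(2 * A / B) / (2 * A / B + 2) = A / (A + B)" if "A > 0" "B > 0" for A B :: real
      using that by (simp add: field_simps)
    from this[of "1 + k\<^sup>2" "(1 - k)\<^sup>2"] show ?thesis
      using k by (simp only: add_pos_nonneg zero_le_power2 zero_less_power diff_gt_0_iff_gt zero_less_one)
  qed
  finally show ?thesis
    using that[of x y] s xy k by (simp add: G_def distinct_pairs_def x_def y_def)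
qed

lemma exists_large_moebius_annulus:
  assumes r: "0 < r" "r < 1" and e: "0 < e" "e < 1"
  obtains x y where "(x, y) \<in> distinct_pairs (annulus r 1)"
    "2 - e \<le> tanh (moebius_metric (annulus r 1) x y / 2) / triangular_ratio_metric (annulus r 1) x y"
proof -
  define G where "G = annulus r 1"
  \<comment> \<open>Half the width of the annulus is \<open>d\<close>, so \<open>x\<close> lies
    midway between the circles. The choice \<open>t = e * d\<close> makes the final quotient
    \<open>(2 * d - t) / d\<close> exactly \<open>2 - e\<close>, and \<open>e < 1\<close> keeps
    \<open>y\<close> inside.\<close>
  define d t where "d = (1 - r) / 2" and "t = e * ((1 - r) / 2)"
  define x y :: complex where "x = of_real (r + d)" and "y = of_real (r + d + t)"
  have dt: "0 < t" "t < d" "r + d + d = 1" "0 < d"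
    using r e by (auto simp: d_def t_def)
  have G: "open G" "bounded G" by (auto simp: G_def open_annulus bounded_annulus)
  have nx: "norm x = r + d" and ny: "norm y = r + d + t" and nxy: "norm (x - y) = t"
    using r dt by (simp_all add: x_def y_def flip: of_real_diff of_real_add)
  have xy: "x \<in> G" "y \<in> G" "x \<noteq> y"
    using r dt nx ny nxy by (auto simp: G_def annulus_def)
  have fr: "of_real r \<in> frontier G" "of_real 1 \<in> frontier G"
    unfolding G_def using of_real_frontier_annulus r by blast+
  have cr: "cross_ratio (of_real r) x (of_real 1) y = 2 * t / (d - t)"
  proof -
    have "norm (of_real r - of_real 1 :: complex) = 2 * d"
      "norm (of_real r - x) = d" "norm (of_real 1 - y) = d - t"
      unfolding x_def y_def of_real_diff[symmetric] norm_of_real using dt by auto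
    then show ?thesis using nxy dt by (simp add: cross_ratio_def norm_minus_commute field_simps)
  qed
  have "t / d = (2 * t / (d - t)) / (2 * t / (d - t) + 2)"
    using dt by (simp add: field_simps)
  also have "\<dots> \<le> tanh (moebius_metric G x y / 2)"
    using dt cr by (intro tanh_half_moebius_ge[OF G xy(1,2) fr]) auto
  finally have T: "t / d \<le> tanh (moebius_metric G x y / 2)" .
  \<comment> \<open>Comparing norms gives at least \<open>d + (d - t)\<close> on the outer circle
    and \<open>d + (d + t)\<close> on the inner one.\<close>
  have "2 * d - t \<le> norm (x - z) + norm (z - y)" if "z \<in> frontier G" for z
  proof -
    have "norm z = r \<or> norm z = 1" using that norm_frontier_annulus by (auto simp: G_def)
    then show ?thesis
      using norm_triangle_ineq3[of x z] norm_triangle_ineq3[of z y] nx ny dt by auto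
  qed
  then have I: "2 * d - t \<le> (INF z\<in>frontier G. norm (x - z) + norm (z - y))"
    using fr by (intro cINF_greatest) auto
  have "triangular_ratio_metric G x y \<le> t / (2 * d - t)"
    unfolding triangular_ratio_metric_def nxy using I dt by (intro divide_left_mono) auto
  moreover have "0 < triangular_ratio_metric G x y"
    unfolding triangular_ratio_metric_def nxy using I dt by auto
  moreover have "0 \<le> tanh (moebius_metric G x y / 2)"
    by (rule order_trans[OF _ T]) (use dt in simp)
  ultimately have "(t / d) / (t / (2 * d - t)) \<le>
      tanh (moebius_metric G x y / 2) / triangular_ratio_metric G x y"
    using T dt by (intro frac_le) auto
  moreover have "(t / d) / (t / (2 * d - t)) = 2 - e"
    using dt by (simp add: field_simps) (simp add: t_def d_def)
  ultimately show ?thesis using that[of x y] xy by (simp add: G_def distinct_pairs_def)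
qed

section \<open>Infima and suprema of the quotients\<close>

lemma quotient_bounds:
  fixes G :: "'a::euclidean_space set"
  assumes "open G" "bounded G" and p: "(x, y) \<in> distinct_pairs G"
  defines "T \<equiv> tanh (moebius_metric G x y / 2)"
  shows "1 / 2 \<le> T / triangular_ratio_metric G x y"
    "1 \<le> T / j_star_metric G x y" "T / j_star_metric G x y \<le> 2"
    "T / triangular_ratio_metric G x y \<le> T / j_star_metric G x y"
proof -
  have xy: "x \<in> G" "y \<in> G" "x \<noteq> y" using p by (auto simp: distinct_pairs_def)
  note j = j_star_pos[OF assms(1,2) xy]
  note js = j_star_le_triangular_ratio[OF assms(1,2) xy(1,2)]
  note lo = j_star_le_tanh_half_moebius[OF assms(1,2) xy(1,2), folded T_def]
  note hi = tanh_half_moebius_le_j_star[OF assms(1,2) xy(1,2), folded T_def]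
  show "1 / 2 \<le> T / triangular_ratio_metric G x y"
    "1 \<le> T / j_star_metric G x y" "T / j_star_metric G x y \<le> 2"
    using j js lo hi by (auto simp: pos_le_divide_eq pos_divide_le_eq)
  show "T / triangular_ratio_metric G x y \<le> T / j_star_metric G x y"
    using j js lo by (intro divide_left_mono) auto
qed

text \<open>One pair serves both infima, and \<open>q\<close> tends to \<open>1 / 2\<close> as
  \<open>k\<close> tends to 0, which closes both intervals onto their left endpoints.\<close>

lemma annulus_bounds:
  fixes k :: real
  assumes k: "0 < k" "k < 1"
  defines "G \<equiv> annulus (k\<^sup>2) 1" and "q \<equiv> (1 + k\<^sup>2) / ((1 + k\<^sup>2) + (1 - k)\<^sup>2)"
  shows "(INF (x, y)\<in>distinct_pairs G.
      tanh (moebius_metric G x y / 2) / triangular_ratio_metric G x y) \<in> {1 / 2..q}"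
    and "(INF (x, y)\<in>distinct_pairs G.
      tanh (moebius_metric G x y / 2) / j_star_metric G x y) \<in> {1..2 * q}"
proof -
  have G: "open G" "bounded G" by (auto simp: G_def open_annulus bounded_annulus)
  obtain x y where xy: "(x, y) \<in> distinct_pairs G" "1 \<le> triangular_ratio_metric G x y"
    "tanh (moebius_metric G x y / 2) \<le> q"
    using exists_small_moebius_annulus[OF k] unfolding G_def q_def by blast
  then have mem: "x \<in> G" "y \<in> G" "x \<noteq> y" by (auto simp: distinct_pairs_def)
  note lower = quotient_bounds(1,2)[OF G]
  have T: "0 \<le> tanh (moebius_metric G x y / 2)"
    using j_star_le_tanh_half_moebius[OF G mem(1,2)] j_star_pos[OF G mem] by linarith
  have "0 \<le> q" using T xy(3) by linarith
  \<comment> \<open>The triangular ratio is at least 1 here and at most twice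
    \<open>j_star_metric\<close>; this explains the factor 2 in \<open>2 * q\<close>.\<close>
  have j: "1 / 2 \<le> j_star_metric G x y"
    using j_star_le_triangular_ratio(2)[OF G mem(1,2)] xy(2) by linarith
  have "tanh (moebius_metric G x y / 2) / triangular_ratio_metric G x y \<le> q / 1"
    using \<open>0 \<le> q\<close> xy by (intro frac_le) auto
  moreover have "(INF (x, y)\<in>distinct_pairs G.
      tanh (moebius_metric G x y / 2) / triangular_ratio_metric G x y)
      \<le> tanh (moebius_metric G x y / 2) / triangular_ratio_metric G x y"
    using lower by (intro cINF_lower2[OF _ xy(1)] bdd_belowI2[of _ "1 / 2"]) auto
  moreover have "1 / 2 \<le> (INF (x, y)\<in>distinct_pairs G.
      tanh (moebius_metric G x y / 2) / triangular_ratio_metric G x y)"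
    using xy(1) lower by (intro cINF_greatest) auto
  ultimately show "(INF (x, y)\<in>distinct_pairs G.
      tanh (moebius_metric G x y / 2) / triangular_ratio_metric G x y) \<in> {1 / 2..q}"
    by simp
  have "tanh (moebius_metric G x y / 2) / j_star_metric G x y \<le> q / (1 / 2)"
    using \<open>0 \<le> q\<close> xy j by (intro frac_le) auto
  moreover have "(INF (x, y)\<in>distinct_pairs G.
      tanh (moebius_metric G x y / 2) / j_star_metric G x y)
      \<le> tanh (moebius_metric G x y / 2) / j_star_metric G x y"
    using lower by (intro cINF_lower2[OF _ xy(1)] bdd_belowI2[of _ 1]) auto
  moreover have "1 \<le> (INF (x, y)\<in>distinct_pairs G.
      tanh (moebius_metric G x y / 2) / j_star_metric G x y)"
    using xy(1) lower by (intro cINF_greatest) auto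
  ultimately show "(INF (x, y)\<in>distinct_pairs G.
      tanh (moebius_metric G x y / 2) / j_star_metric G x y) \<in> {1..2 * q}"
    by simp
qed

lemma SUP_annulus:
  assumes r: "0 < r" "r < 1"
  defines "G \<equiv> annulus r 1"
  shows "(SUP (x, y)\<in>distinct_pairs G.
      tanh (moebius_metric G x y / 2) / j_star_metric G x y) = 2"
    and "(SUP (x, y)\<in>distinct_pairs G.
      tanh (moebius_metric G x y / 2) / triangular_ratio_metric G x y) = 2"
proof -
  have G: "open G" "bounded G" by (auto simp: G_def open_annulus bounded_annulus)
  have large: "\<exists>p\<in>distinct_pairs G.
      c < (case p of (x, y) \<Rightarrow> tanh (moebius_metric G x y / 2) / triangular_ratio_metric G x y)" if "c < 2" for c
  proof -
    have "0 < min 1 (2 - c)" using that by simp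
    from dense[OF this] obtain e where e: "0 < e" "e < 1" "c < 2 - e" by auto
    obtain x y where "(x, y) \<in> distinct_pairs G"
      "2 - e \<le> tanh (moebius_metric G x y / 2) / triangular_ratio_metric G x y"
      using exists_large_moebius_annulus[OF r e(1,2)] unfolding G_def by blast
    with e(3) show ?thesis by (intro bexI[of _ "(x, y)"]) auto
  qed
  note upper = quotient_bounds(3,4)[OF G]
  have ne: "distinct_pairs G \<noteq> {}" using large[of 0] by auto
  \<comment> \<open>Stated for any \<open>f\<close> between the triangular ratio quotient and 2, so
    that near-extremal pairs for the smaller quotient settle both suprema.\<close>
  have eq_2: "(SUP p\<in>distinct_pairs G. f p) = 2"
    if le: "\<And>p. p \<in> distinct_pairs G \<Longrightarrow> f p \<le> 2"
      and ge: "\<And>p. p \<in> distinct_pairs G \<Longrightarrow>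
        (case p of (x, y) \<Rightarrow> tanh (moebius_metric G x y / 2) / triangular_ratio_metric G x y) \<le> f p"
    for f :: "complex \<times> complex \<Rightarrow> real"
  proof (rule antisym)
    show "(SUP p\<in>distinct_pairs G. f p) \<le> 2" using le ne by (intro cSUP_least)
    have bdd: "bdd_above (f ` distinct_pairs G)" using le by (rule bdd_aboveI2)
    show "2 \<le> (SUP p\<in>distinct_pairs G. f p)"
    proof (rule dense_le)
      fix c :: real assume "c < 2"
      then obtain p where p: "p \<in> distinct_pairs G"
        "c < (case p of (x, y) \<Rightarrow> tanh (moebius_metric G x y / 2) / triangular_ratio_metric G x y)"
        using large[of c] by blast
      with ge[OF p(1)] cSUP_upper[OF p(1) bdd] show "c \<le> (SUP p\<in>distinct_pairs G. f p)"
        by linarith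
    qed
  qed
  show "(SUP (x, y)\<in>distinct_pairs G.
      tanh (moebius_metric G x y / 2) / j_star_metric G x y) = 2"
    using upper by (intro eq_2) auto
  show "(SUP (x, y)\<in>distinct_pairs G.
      tanh (moebius_metric G x y / 2) / triangular_ratio_metric G x y) = 2"
    using order_trans[OF upper(2,1)] by (intro eq_2) auto
qed

theorem theorem4p8:
  "(\<forall>r::real. 0 < r \<and> r < 1 \<longrightarrow>
      (\<forall>x\<in>annulus r 1. \<forall>y\<in>annulus r 1.
         1 / 2 * triangular_ratio_metric (annulus r 1) x y \<le> j_star_metric (annulus r 1) x y \<and>
         j_star_metric (annulus r 1) x y \<le> tanh (moebius_metric (annulus r 1) x y / 2) \<and>
         tanh (moebius_metric (annulus r 1) x y / 2) \<le> 2 * j_star_metric (annulus r 1) x y \<and>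
         2 * j_star_metric (annulus r 1) x y \<le> 2 * triangular_ratio_metric (annulus r 1) x y)) \<and>
   ((\<lambda>r::real. INF (x, y)\<in>distinct_pairs (annulus r 1).
        tanh (moebius_metric (annulus r 1) x y / 2) / triangular_ratio_metric (annulus r 1) x y)
      \<longlongrightarrow> 1 / 2) (at_right 0) \<and>
   ((\<lambda>r::real. INF (x, y)\<in>distinct_pairs (annulus r 1).
        tanh (moebius_metric (annulus r 1) x y / 2) / j_star_metric (annulus r 1) x y)
      \<longlongrightarrow> 1) (at_right 0) \<and>
   (\<forall>r::real. 0 < r \<and> r < 1 \<longrightarrow>
      (SUP (x, y)\<in>distinct_pairs (annulus r 1).
         tanh (moebius_metric (annulus r 1) x y / 2) / j_star_metric (annulus r 1) x y) = 2 \<and>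
      (SUP (x, y)\<in>distinct_pairs (annulus r 1).
         tanh (moebius_metric (annulus r 1) x y / 2) / triangular_ratio_metric (annulus r 1) x y) = 2)"
proof (intro conjI allI impI ballI)
  fix r :: real and x y assume "0 < r \<and> r < 1" and xy: "x \<in> annulus r 1" "y \<in> annulus r 1"
  note * = open_annulus bounded_annulus xy
  show "1 / 2 * triangular_ratio_metric (annulus r 1) x y \<le> j_star_metric (annulus r 1) x y"
    using j_star_le_triangular_ratio(2)[OF *] by simp
  show "2 * j_star_metric (annulus r 1) x y \<le> 2 * triangular_ratio_metric (annulus r 1) x y"
    using j_star_le_triangular_ratio(1)[OF *] by simp
  show "j_star_metric (annulus r 1) x y \<le> tanh (moebius_metric (annulus r 1) x y / 2)"
    by (rule j_star_le_tanh_half_moebius[OF *])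
  show "tanh (moebius_metric (annulus r 1) x y / 2) \<le> 2 * j_star_metric (annulus r 1) x y"
    by (rule tanh_half_moebius_le_j_star[OF *])
next
  \<comment> \<open>This is the bound of \<open>annulus_bounds\<close> at \<open>k = sqrt r\<close>;
    the squares of \<open>sqrt r\<close> stay unsimplified so that folding \<open>q_def\<close>
    matches it literally.\<close>
  define q :: "real \<Rightarrow> real"
    where "q r = (1 + (sqrt r)\<^sup>2) / ((1 + (sqrt r)\<^sup>2) + (1 - sqrt r)\<^sup>2)" for r
  have q: "(q \<longlongrightarrow> 1 / 2) (at_right 0)"
    unfolding q_def by (rule tendsto_eq_intros refl | simp)+
  have small: "\<forall>\<^sub>F r in at_right 0. 0 < r \<and> r < (1::real)"
    by (auto intro!: eventually_conj eventually_at_right_less eventually_at_right_real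
        simp: eventually_at_right_field intro: exI[of _ 1])
  have k: "0 < sqrt r" "sqrt r < 1" "(sqrt r)\<^sup>2 = r" if "0 < r \<and> r < 1" for r :: real
    using that by auto
  show "((\<lambda>r::real. INF (x, y)\<in>distinct_pairs (annulus r 1).
      tanh (moebius_metric (annulus r 1) x y / 2) / triangular_ratio_metric (annulus r 1) x y)
      \<longlongrightarrow> 1 / 2) (at_right 0)"
  \<comment> \<open>The infimum is squeezed between its constant lower bound and \<open>q r\<close>
    for \<open>r\<close> in the unit interval, which suffices for the limit at \<open>0\<close> from
    the right.\<close>
  proof (rule tendsto_sandwich[OF _ _ tendsto_const q]; rule eventually_mono[OF small])
    fix r :: real assume "0 < r \<and> r < 1"
    note r = k[OF this]
    note * = annulus_bounds(1)[OF r(1,2), folded q_def, unfolded r(3)]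
    show "1 / 2 \<le> (INF (x, y)\<in>distinct_pairs (annulus r 1).
        tanh (moebius_metric (annulus r 1) x y / 2) / triangular_ratio_metric (annulus r 1) x y)"
      and "(INF (x, y)\<in>distinct_pairs (annulus r 1).
        tanh (moebius_metric (annulus r 1) x y / 2) / triangular_ratio_metric (annulus r 1) x y) \<le> q r"
      using * by (simp_all only: atLeastAtMost_iff)
  qed
  have q2: "((\<lambda>r. 2 * q r) \<longlongrightarrow> 1) (at_right 0)"
    using tendsto_mult_left[OF q, of 2] by simp
  show "((\<lambda>r::real. INF (x, y)\<in>distinct_pairs (annulus r 1).
      tanh (moebius_metric (annulus r 1) x y / 2) / j_star_metric (annulus r 1) x y)
      \<longlongrightarrow> 1) (at_right 0)"
  proof (rule tendsto_sandwich[OF _ _ tendsto_const q2]; rule eventually_mono[OF small])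
    fix r :: real assume "0 < r \<and> r < 1"
    note r = k[OF this]
    note * = annulus_bounds(2)[OF r(1,2), folded q_def, unfolded r(3)]
    show "1 \<le> (INF (x, y)\<in>distinct_pairs (annulus r 1).
        tanh (moebius_metric (annulus r 1) x y / 2) / j_star_metric (annulus r 1) x y)"
      and "(INF (x, y)\<in>distinct_pairs (annulus r 1).
        tanh (moebius_metric (annulus r 1) x y / 2) / j_star_metric (annulus r 1) x y) \<le> 2 * q r"
      using * by (simp_all only: atLeastAtMost_iff)
  qed
next
  fix r :: real assume "0 < r \<and> r < 1"
  then show "(SUP (x, y)\<in>distinct_pairs (annulus r 1).
      tanh (moebius_metric (annulus r 1) x y / 2) / j_star_metric (annulus r 1) x y) = 2"
    and "(SUP (x, y)\<in>distinct_pairs (annulus r 1).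
      tanh (moebius_metric (annulus r 1) x y / 2) / triangular_ratio_metric (annulus r 1) x y) = 2"
    using SUP_annulus by auto
qed

end
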